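(* The index of $\Gamma$ in $\mathrm{Sp}(4,\mathbb{Z})$ is $6$. Moreover, there is a short exact sequence $$1\to\Gamma(2)\to\Gamma\to\Sigma_5\to1.$$
   Context: $\Gamma$ is the subgroup of $\mathrm{Sp}(4,\mathbb{Z})$ generated by the four matrices $$\begin{pmatrix}1&0&0&0\\0&1&0&0\\1&0&1&0\\0&0&0&1\end{pmatrix},\quad \begin{pmatrix}1&0&-1&1\\0&1&1&-1\\0&0&1&0\\0&0&0&1\end{pmatrix},\quad \begin{pmatrix}1&0&0&0\\0&1&0&0\\0&0&1&0\\0&1&0&1\end{pmatrix},\quad \begin{pmatrix}1&0&0&0\\0&1&0&-1\\0&0&1&0\\0&0&0&1\end{pmatrix}.$$ Here $\mathrm{Sp}(4,\mathbb{Z})$ is the symplectic group of the form $\begin{pmatrix}0&I_2\\-I_2&0\end{pmatrix}$. $\Gamma(2)=\mathrm{Ker}(\mathrm{Sp}(4,\mathbb{Z})\to\mathrm{Sp}(4,\mathbb{Z}/2\mathbb{Z}))$ is the congruence subgroup of level two, and $\Sigma_5$ is the symmetric group on five letters. The map $\Gamma(2)\to\Gamma$ is the inclusion, and $\Gamma\to\Sigma_5$ is the reduction modulo $2$ followed by the isomorphism $\mathrm{Sp}(4,\mathbb{Z}/2\mathbb{Z})\cong\Sigma_6$ that sends the four generators of $\Gamma$ above to the transpositions $(12),(23),(34),(45)$, with image $\Sigma_5\subset\Sigma_6$. *)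

theory Defs
  imports
    "HOL-Analysis.Cartesian_Space"
    "HOL-Algebra.Sym_Groups"
    "HOL-Library.Z2"
begin

definition mat_of_rows :: "'a::zero list list \<Rightarrow> 'a^4^4" where
  "mat_of_rows xss = vector (map vector xss)"

definition symp_form :: "'a::comm_ring_1^4^4" where
  "symp_form = mat_of_rows
    [[ 0,  0, 1, 0],
     [ 0,  0, 0, 1],
     [-1,  0, 0, 0],
     [ 0, -1, 0, 0]]"

definition Sp4 :: "('a::comm_ring_1^4^4) monoid" where
  "Sp4 = \<lparr>carrier = {A. Finite_Cartesian_Product.transpose A ** symp_form ** A = symp_form},
          mult = (**), one = mat 1\<rparr>"

abbreviation Sp4Z :: "(int^4^4) monoid" where "Sp4Z \<equiv> Sp4"

(* bit is the library's field of integers modulo 2 *)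
abbreviation Sp4F2 :: "(bit^4^4) monoid" where "Sp4F2 \<equiv> Sp4"

definition red2 :: "int^4^4 \<Rightarrow> bit^4^4" where
  "red2 A = (\<chi> i j. of_int (A $ i $ j))"

definition Gamma2 :: "(int^4^4) set" where
  "Gamma2 = kernel Sp4Z Sp4F2 red2"

definition gen1 :: "int^4^4" where
  "gen1 = mat_of_rows
    [[1, 0, 0, 0],
     [0, 1, 0, 0],
     [1, 0, 1, 0],
     [0, 0, 0, 1]]"

definition gen2 :: "int^4^4" where
  "gen2 = mat_of_rows
    [[1, 0, -1,  1],
     [0, 1,  1, -1],
     [0, 0,  1,  0],
     [0, 0,  0,  1]]"

definition gen3 :: "int^4^4" where
  "gen3 = mat_of_rows
    [[1, 0, 0, 0],
     [0, 1, 0, 0],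
     [0, 0, 1, 0],
     [0, 1, 0, 1]]"

definition gen4 :: "int^4^4" where
  "gen4 = mat_of_rows
    [[1, 0, 0,  0],
     [0, 1, 0, -1],
     [0, 0, 1,  0],
     [0, 0, 0,  1]]"

definition Gam :: "(int^4^4) set" where
  "Gam = generate Sp4Z {gen1, gen2, gen3, gen4}"

text \<open>
  The isomorphism from \<open>Sp(4, Z/2Z)\<close> to the symmetric group on \<open>{1..6}\<close> that sends the
  reductions of the four generators to the transpositions (12), (23), (34), (45).
  Functions in \<^const>\<open>iso\<close> are arbitrary outside the carrier, so this is a predicate
  rather than a single function.
\<close>

definition marked_iso :: "(bit^4^4 \<Rightarrow> (nat \<Rightarrow> nat)) \<Rightarrow> bool" where
  "marked_iso \<phi> \<longleftrightarrow>
     \<phi> \<in> iso Sp4F2 (sym_group 6) \<and>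
     \<phi> (red2 gen1) = Transposition.transpose 1 2 \<and>
     \<phi> (red2 gen2) = Transposition.transpose 2 3 \<and>
     \<phi> (red2 gen3) = Transposition.transpose 3 4 \<and>
     \<phi> (red2 gen4) = Transposition.transpose 4 5"

text \<open>
  \<open>1 \<rightarrow> A \<rightarrow> B \<rightarrow> C \<rightarrow> 1\<close>. The library's \<open>short_exact_sequence\<close> forces the three groups
  to have the same element type, which matrices and permutations do not.
\<close>

definition short_exact ::
  "'a monoid \<Rightarrow> ('a \<Rightarrow> 'b) \<Rightarrow> 'b monoid \<Rightarrow> ('b \<Rightarrow> 'c) \<Rightarrow> 'c monoid \<Rightarrow> bool" where
  "short_exact A f B g C \<longleftrightarrow>
     group A \<and> group B \<and> group C \<and>
     f \<in> mon A B \<and> g \<in> epi B C \<and> kernel B C g = f ` carrier A"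

lemma mat_of_rows_nth:
  "mat_of_rows [[a11,a12,a13,a14],[a21,a22,a23,a24],[a31,a32,a33,a34],[a41,a42,a43,a44]] =
   (\<chi> i j. if i = 1 then (if j = 1 then a11 else if j = 2 then a12 else if j = 3 then a13 else a14)
      else if i = 2 then (if j = 1 then a21 else if j = 2 then a22 else if j = 3 then a23 else a24)
      else if i = 3 then (if j = 1 then a31 else if j = 2 then a32 else if j = 3 then a33 else a34)
      else (if j = 1 then a41 else if j = 2 then a42 else if j = 3 then a43 else a44))"
  by (simp add: vec_eq_iff forall_4 mat_of_rows_def vector_def)

lemma generators_in_Sp4Z: "{gen1, gen2, gen3, gen4} \<subseteq> carrier Sp4Z"
  by (simp add: Sp4_def gen1_def gen2_def gen3_def gen4_def symp_form_def mat_of_rows_nth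
      vec_eq_iff forall_4 matrix_matrix_mult_def sum_4 Finite_Cartesian_Product.transpose_def)

end

theory Submission
  imports Defs
begin

text \<open>
  The proof rests on two facts: \<open>Gam\<close> contains the whole congruence subgroup \<open>Gamma2\<close>, and
  \<open>Sp(4, Z/2Z)\<close> permutes six objects in such a way that the generators act by
  \<open>(12), (23), (34), (45)\<close>. Then \<open>Gam\<close> is the full preimage of the subgroup generated by these
  transpositions, the stabilizer of \<open>6\<close>, which is the symmetric group on five letters and has index six
  in the symmetric group on six letters. Since reduction modulo 2 followed by the action is onto, cosets
  can be counted in the finite group (\<open>card_rcosets_image\<close>).

  For the first fact (\<open>Gamma2_subset_Gam\<close>), braid-like relations among the generators show that \<open>Gam\<close>
  contains enough elementary symplectic matrices of level two. A matrix in \<open>Gamma2\<close> is then reduced to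
  the identity by row operations of level two. The key point is a Euclidean algorithm with even quotients
  (\<open>odd_even_descent\<close>): the upper left entry is odd and the rest of its column is even, so the
  upper left entry never has the same absolute value as another one. Hence the algorithm does not get stuck
  before that entry divides its column, and then it is a unit.

  For the second fact, the six objects are the quadratic forms of Arf invariant \<open>1\<close> that polarize to the
  symplectic form modulo 2. Symplectic matrices permute the quadratic forms with this polarization, and
  they preserve the Arf invariant because it is determined by how often a form takes the value \<open>1\<close>
  (\<open>arf_act\<close>). The action on the six odd forms is faithful (\<open>perm_of_inj\<close>), and it is onto because
  one more integral transvection provides \<open>(56)\<close> (\<open>perm_of_red2_surj\<close>).
\<close>

section \<open>Four by four matrices and the symplectic groups\<close>

lemma mat_of_rows_nths:
  assumes "M = mat_of_rows [[a11,a12,a13,a14],[a21,a22,a23,a24],[a31,a32,a33,a34],[a41,a42,a43,a44]]"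
  shows "M $ 1 $ 1 = a11" "M $ 1 $ 2 = a12" "M $ 1 $ 3 = a13" "M $ 1 $ 4 = a14"
    "M $ 2 $ 1 = a21" "M $ 2 $ 2 = a22" "M $ 2 $ 3 = a23" "M $ 2 $ 4 = a24"
    "M $ 3 $ 1 = a31" "M $ 3 $ 2 = a32" "M $ 3 $ 3 = a33" "M $ 3 $ 4 = a34"
    "M $ 4 $ 1 = a41" "M $ 4 $ 2 = a42" "M $ 4 $ 3 = a43" "M $ 4 $ 4 = a44"
  using assms by (simp_all add: mat_of_rows_nth)

lemmas mat_of_rows_entries [simp] = mat_of_rows_nths[OF refl]

lemma mat4_eq_iff:
  fixes A B :: "'a^4^4"
  shows "A = B \<longleftrightarrow> (\<forall>i. A$i$1 = B$i$1 \<and> A$i$2 = B$i$2 \<and> A$i$3 = B$i$3 \<and> A$i$4 = B$i$4)"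
  by (simp add: vec_eq_iff forall_4)

lemma mat4_mult_entry:
  fixes A B :: "'a::semiring_1^4^4"
  shows "(A ** B)$i$j = A$i$1 * B$1$j + A$i$2 * B$2$j + A$i$3 * B$3$j + A$i$4 * B$4$j"
  by (simp add: matrix_matrix_mult_def sum_4)

lemma mat_1_of_rows:
  "mat 1 = (mat_of_rows [[1,0,0,0],[0,1,0,0],[0,0,1,0],[0,0,0,1]] :: 'a::semiring_1^4^4)"
  by (simp add: mat4_eq_iff forall_4 mat_def)

lemma mat_of_rows_mult:
  "mat_of_rows [[a11,a12,a13,a14],[a21,a22,a23,a24],[a31,a32,a33,a34],[a41,a42,a43,a44]] **
   mat_of_rows [[b11,b12,b13,b14],[b21,b22,b23,b24],[b31,b32,b33,b34],[b41,b42,b43,b44::'a::semiring_1]] =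
   mat_of_rows
    [[a11*b11+a12*b21+a13*b31+a14*b41, a11*b12+a12*b22+a13*b32+a14*b42, a11*b13+a12*b23+a13*b33+a14*b43, a11*b14+a12*b24+a13*b34+a14*b44],
     [a21*b11+a22*b21+a23*b31+a24*b41, a21*b12+a22*b22+a23*b32+a24*b42, a21*b13+a22*b23+a23*b33+a24*b43, a21*b14+a22*b24+a23*b34+a24*b44],
     [a31*b11+a32*b21+a33*b31+a34*b41, a31*b12+a32*b22+a33*b32+a34*b42, a31*b13+a32*b23+a33*b33+a34*b43, a31*b14+a32*b24+a33*b34+a34*b44],
     [a41*b11+a42*b21+a43*b31+a44*b41, a41*b12+a42*b22+a43*b32+a44*b42, a41*b13+a42*b23+a43*b33+a44*b43, a41*b14+a42*b24+a43*b34+a44*b44]]"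
  by (simp add: mat4_eq_iff forall_4 mat4_mult_entry)

definition pairing :: "'a::comm_ring_1^4 \<Rightarrow> 'a^4 \<Rightarrow> 'a" where
  "pairing x y = x$1 * y$3 - x$3 * y$1 + x$2 * y$4 - x$4 * y$2"

lemma Sp4_carrier_columns:
  "A \<in> carrier Sp4 \<longleftrightarrow> (\<forall>i j. pairing (column i A) (column j A) = symp_form $ i $ j)"
  by (simp add: Sp4_def vec_eq_iff mat4_mult_entry pairing_def column_def symp_form_def
      Finite_Cartesian_Product.transpose_def algebra_simps)

lemma Sp4_carrier_relations:
  fixes A :: "'a::comm_ring_1^4^4"
  assumes "A \<in> carrier Sp4"
  shows "A$1$i * A$3$j - A$3$i * A$1$j + A$2$i * A$4$j - A$4$i * A$2$j = symp_form $ i $ j"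
  using assms by (simp add: Sp4_carrier_columns pairing_def column_def)

lemma Sp4_mult [simp]: "A \<otimes>\<^bsub>Sp4\<^esub> B = A ** B"
  and Sp4_one [simp]: "\<one>\<^bsub>Sp4\<^esub> = mat 1"
  by (simp_all add: Sp4_def)

text \<open>Entrywise base change; reduction modulo 2 and the embedding into real matrices are both instances.\<close>
definition of_int_mat :: "int^4^4 \<Rightarrow> 'a::comm_ring_1^4^4" where
  "of_int_mat A = (\<chi> i j. of_int (A $ i $ j))"

lemma of_int_mat_entry [simp]: "of_int_mat A $ i $ j = of_int (A $ i $ j)"
  by (simp add: of_int_mat_def)

lemma of_int_mat_mult: "of_int_mat (A ** B) = of_int_mat A ** of_int_mat B"
  by (simp add: vec_eq_iff mat4_mult_entry)

lemma of_int_mat_1: "of_int_mat (mat 1) = mat 1"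
  by (simp add: vec_eq_iff mat_def)

lemma of_int_mat_Sp4:
  "A \<in> carrier Sp4 \<Longrightarrow> of_int_mat A \<in> carrier Sp4"
proof -
  assume A: "A \<in> carrier Sp4"
  have "pairing (column i (of_int_mat A :: 'a^4^4)) (column j (of_int_mat A)) = symp_form $ i $ j" for i j
  proof -
    have "pairing (column i (of_int_mat A :: 'a^4^4)) (column j (of_int_mat A)) = of_int (pairing (column i A) (column j A))"
      by (simp add: pairing_def column_def)
    also have "\<dots> = of_int (symp_form $ i $ j)"
      using A by (simp add: Sp4_carrier_columns)
    also have "\<dots> = symp_form $ i $ j"
      using exhaust_4[of i] exhaust_4[of j] by (auto simp: symp_form_def)
    finally show ?thesis .
  qed
  then show ?thesis by (simp add: Sp4_carrier_columns)
qed

lemma symp_form_sq: "symp_form ** symp_form = - mat 1"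
  by (simp add: symp_form_def mat_of_rows_mult mat_1_of_rows mat4_eq_iff forall_4)

text \<open>
  A symplectic matrix \<open>A\<close> has the left inverse \<open>- J A\<^sup>T J\<close>. That this inverse is again
  symplectic amounts to \<open>A J A\<^sup>T = J\<close>, for which it must also be a right inverse. This is
  immediate over a field, and over the integers it follows by passing to real matrices.
\<close>
lemma group_Sp4:
  assumes inv: "\<And>A B :: 'a::comm_ring_1^4^4. A ** B = mat 1 \<Longrightarrow> B ** A = mat 1"
  shows "group (Sp4 :: ('a^4^4) monoid)"
proof (rule groupI)
  fix A :: "'a^4^4" assume A: "A \<in> carrier Sp4"
  let ?T = "Finite_Cartesian_Product.transpose A" and ?J = "symp_form :: 'a^4^4"
  define B where "B = (- ?J) ** ?T ** ?J"
  have neg: "(- X) ** Y = - (X ** Y)" for X Y :: "'a^4^4"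
    by (simp add: vec_eq_iff mat4_mult_entry)
  have BA: "B ** A = mat 1"
    using A symp_form_sq[where 'a='a]
    by (simp add: B_def Sp4_def neg flip: matrix_mul_assoc)
  then have AB: "A ** B = mat 1" by (rule inv)
  have "Finite_Cartesian_Product.transpose B ** ?J ** B =
        Finite_Cartesian_Product.transpose B ** (?T ** ?J ** A) ** B"
    using A by (simp add: Sp4_def)
  also have "\<dots> = Finite_Cartesian_Product.transpose (A ** B) ** ?J ** (A ** B)"
    by (simp add: matrix_transpose_mul matrix_mul_assoc)
  also have "\<dots> = ?J" by (simp add: AB transpose_mat)
  finally have "B \<in> carrier Sp4" by (simp add: Sp4_def)
  with BA show "\<exists>B\<in>carrier Sp4. B \<otimes>\<^bsub>Sp4\<^esub> A = \<one>\<^bsub>Sp4\<^esub>" by auto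
next
  fix A B :: "'a^4^4" assume "A \<in> carrier Sp4" "B \<in> carrier Sp4"
  then have A: "Finite_Cartesian_Product.transpose A ** symp_form ** A = symp_form"
    and B: "Finite_Cartesian_Product.transpose B ** symp_form ** B = symp_form"
    by (simp_all add: Sp4_def)
  have "Finite_Cartesian_Product.transpose (A ** B) ** symp_form ** (A ** B)
      = Finite_Cartesian_Product.transpose B ** (Finite_Cartesian_Product.transpose A ** symp_form ** A) ** B"
    by (simp add: matrix_transpose_mul matrix_mul_assoc)
  also have "\<dots> = symp_form" by (simp only: A B)
  finally show "A \<otimes>\<^bsub>Sp4\<^esub> B \<in> carrier Sp4"
    by (simp add: Sp4_def)
next
  show "\<one>\<^bsub>Sp4\<^esub> \<in> carrier (Sp4 :: ('a^4^4) monoid)"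
    by (simp add: Sp4_def transpose_mat)
qed (simp_all flip: matrix_mul_assoc)

lemma group_Sp4F2: "group Sp4F2"
  by (rule group_Sp4) (rule matrix_left_right_inverse1)

lemma group_Sp4Z: "group Sp4Z"
proof (rule group_Sp4)
  fix A B :: "int^4^4" assume AB: "A ** B = mat 1"
  have "of_int_mat A ** of_int_mat B = (mat 1 :: real^4^4)"
    by (metis AB of_int_mat_mult of_int_mat_1)
  from matrix_left_right_inverse1[OF this] have "of_int_mat (B ** A) = (mat 1 :: real^4^4)"
    by (simp add: of_int_mat_mult)
  then have "of_int ((B ** A)$i$j) = (of_int (mat 1 $ i $ j) :: real)" for i j
    by (simp add: vec_eq_iff mat_def)
  then show "B ** A = mat 1"
    by (simp add: vec_eq_iff)
qed

interpretation Z: group Sp4Z by (rule group_Sp4Z)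
interpretation F: group Sp4F2 by (rule group_Sp4F2)

lemma red2_eq_of_int_mat: "red2 = of_int_mat"
  by (simp add: red2_def of_int_mat_def fun_eq_iff)

interpretation red: group_hom Sp4Z Sp4F2 red2
  by unfold_locales (simp add: hom_def red2_eq_of_int_mat of_int_mat_Sp4 of_int_mat_mult)

lemma of_int_bit_eq_0_iff: "of_int n = (0::bit) \<longleftrightarrow> even n"
  by (metis bit_2_eq_0 even_of_int_iff bit_not_zero_iff dvd_0_right odd_one)

lemma of_int_bit_eq_1_iff: "of_int n = (1::bit) \<longleftrightarrow> odd n"
  using of_int_bit_eq_0_iff[of n] by (cases "of_int n :: bit") auto

lemma Gamma2_iff:
  "A \<in> Gamma2 \<longleftrightarrow> A \<in> carrier Sp4Z \<and> (\<forall>i j. even (A$i$j) \<longleftrightarrow> i \<noteq> j)"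
proof -
  have "red2 A = mat 1 \<longleftrightarrow> (\<forall>i j. even (A$i$j) \<longleftrightarrow> i \<noteq> j)"
    unfolding red2_def vec_eq_iff mat_def
    by (simp add: of_int_bit_eq_0_iff of_int_bit_eq_1_iff if_distrib[of "\<lambda>x. _ = x"] del: bit_not_zero_iff bit_not_one_iff cong: if_cong) metis
  then show ?thesis by (simp add: Gamma2_def kernel_def)
qed

lemma Gamma2_subgroup: "subgroup Gamma2 Sp4Z"
  unfolding Gamma2_def by (rule red.subgroup_kernel)

lemma Gam_subgroup: "subgroup Gam Sp4Z"
  unfolding Gam_def by (rule Z.generate_is_subgroup) (rule generators_in_Sp4Z)

section \<open>Elementary matrices in \<open>Gam\<close>\<close>

text \<open>
  With \<open>e\<^sub>1, e\<^sub>2, f\<^sub>1, f\<^sub>2\<close> the standard basis, the generators are the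
  transvections \<open>x \<mapsto> x + \<langle>x, v\<rangle> v\<close> along
  \<open>v = f\<^sub>1, e\<^sub>1 - e\<^sub>2, f\<^sub>2, e\<^sub>2\<close>. These four vectors form a chain:
  consecutive ones pair to \<open>\<plusminus> 1\<close>, the others to \<open>0\<close>. The relations below
  are shadows of relations in the braid group on five strands.
\<close>

lemma Gam_carrier: "A \<in> Gam \<Longrightarrow> A \<in> carrier Sp4Z"
  using subgroup.subset[OF Gam_subgroup] by blast

lemma Gam_mult: "A \<in> Gam \<Longrightarrow> B \<in> Gam \<Longrightarrow> A ** B \<in> Gam"
  using subgroup.m_closed[OF Gam_subgroup] by simp

lemma gens_in_Gam: "gen1 \<in> Gam" "gen2 \<in> Gam" "gen3 \<in> Gam" "gen4 \<in> Gam"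
  unfolding Gam_def by (auto intro: generate.incl)

lemma Gam_one_parameter:
  fixes X :: "int \<Rightarrow> int^4^4"
  assumes add: "\<And>s t. X (s + t) = X s ** X t" and zero: "X 0 = mat 1"
    and gen: "X c \<in> Gam"
  shows "X (c * t) \<in> Gam"
proof (induction t rule: int_induct[where k = 0])
  case base
  show ?case using subgroup.one_closed[OF Gam_subgroup] by (simp add: zero)
next
  case (step1 i)
  have "X (c * (i + 1)) = X (c * i) ** X c"
    by (simp add: distrib_left flip: add)
  then show ?case using step1 gen by (simp add: Gam_mult)
next
  case (step2 i)
  have inv: "inv\<^bsub>Sp4Z\<^esub> X c \<in> Gam"
    by (rule subgroup.m_inv_closed[OF Gam_subgroup gen])
  have "X c ** inv\<^bsub>Sp4Z\<^esub> X c = mat 1"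
    using Z.r_inv[OF Gam_carrier[OF gen]] by simp
  moreover have "X (c * i) = X (c * (i - 1)) ** X c"
    using add[of "c * (i - 1)" c] by (simp add: algebra_simps)
  ultimately have "X (c * (i - 1)) = X (c * i) ** inv\<^bsub>Sp4Z\<^esub> X c"
    by (simp flip: matrix_mul_assoc)
  then show ?case using step2 inv by (simp add: Gam_mult)
qed

definition U11 :: "int \<Rightarrow> int^4^4" where
  "U11 t = mat_of_rows [[1,0,t,0],[0,1,0,0],[0,0,1,0],[0,0,0,1]]"
definition U12 :: "int \<Rightarrow> int^4^4" where
  "U12 t = mat_of_rows [[1,0,0,t],[0,1,t,0],[0,0,1,0],[0,0,0,1]]"
definition U22 :: "int \<Rightarrow> int^4^4" where
  "U22 t = mat_of_rows [[1,0,0,0],[0,1,0,t],[0,0,1,0],[0,0,0,1]]"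
definition L11 :: "int \<Rightarrow> int^4^4" where
  "L11 t = mat_of_rows [[1,0,0,0],[0,1,0,0],[t,0,1,0],[0,0,0,1]]"
definition L12 :: "int \<Rightarrow> int^4^4" where
  "L12 t = mat_of_rows [[1,0,0,0],[0,1,0,0],[0,t,1,0],[t,0,0,1]]"
definition L22 :: "int \<Rightarrow> int^4^4" where
  "L22 t = mat_of_rows [[1,0,0,0],[0,1,0,0],[0,0,1,0],[0,t,0,1]]"
definition E12 :: "int \<Rightarrow> int^4^4" where
  "E12 t = mat_of_rows [[1,t,0,0],[0,1,0,0],[0,0,1,0],[0,0,-t,1]]"
definition E21 :: "int \<Rightarrow> int^4^4" where
  "E21 t = mat_of_rows [[1,0,0,0],[t,1,0,0],[0,0,1,-t],[0,0,0,1]]"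

lemmas elementary_defs = U11_def U12_def U22_def L11_def L12_def L22_def E12_def E21_def
lemmas gen_defs = gen1_def gen2_def gen3_def gen4_def

lemma elementary_add:
  "U11 (s + t) = U11 s ** U11 t" "U12 (s + t) = U12 s ** U12 t" "U22 (s + t) = U22 s ** U22 t"
  "L11 (s + t) = L11 s ** L11 t" "L12 (s + t) = L12 s ** L12 t" "L22 (s + t) = L22 s ** L22 t"
  "E12 (s + t) = E12 s ** E12 t" "E21 (s + t) = E21 s ** E21 t"
  by (simp_all add: elementary_defs mat_of_rows_mult add.commute)

lemma elementary_0:
  "U11 0 = mat 1" "U12 0 = mat 1" "U22 0 = mat 1" "L11 0 = mat 1" "L12 0 = mat 1" "L22 0 = mat 1"
  "E12 0 = mat 1" "E21 0 = mat 1"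
  by (simp_all add: elementary_defs mat_1_of_rows)

lemma L11_Gam: "L11 t \<in> Gam" and L22_Gam: "L22 t \<in> Gam" and U22_Gam: "U22 t \<in> Gam"
proof -
  have "L11 1 = gen1" "L22 1 = gen3" "U22 (- 1) = gen4"
    by (simp_all add: elementary_defs gen_defs)
  then have base: "L11 1 \<in> Gam" "L22 1 \<in> Gam" "U22 (- 1) \<in> Gam"
    using gens_in_Gam by simp_all
  show "L11 t \<in> Gam"
    using Gam_one_parameter[OF elementary_add(4) elementary_0(4) base(1), of t] by simp
  show "L22 t \<in> Gam"
    using Gam_one_parameter[OF elementary_add(6) elementary_0(6) base(2), of t] by simp
  show "U22 t \<in> Gam"
    using Gam_one_parameter[OF elementary_add(3) elementary_0(3) base(3), of "- t"] by simp
qed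

text \<open>
  An element of \<open>Gam\<close> that fixes \<open>e\<^sub>1, f\<^sub>1\<close> and rotates the plane of \<open>e\<^sub>2, f\<^sub>2\<close>.
  Conjugation by it turns \<open>f\<^sub>2\<close> into \<open>e\<^sub>2\<close> up to sign and thereby yields \<open>E21\<close> from \<open>L12\<close> and
  \<open>E12\<close> from \<open>U12\<close>.
\<close>
definition quarter_turn :: "int^4^4" where
  "quarter_turn = mat_of_rows [[1,0,0,0],[0,0,0,-1],[0,0,1,0],[0,1,0,0]]"

lemma quarter_turn_Gam: "quarter_turn \<in> Gam"
proof -
  have "gen3 ** gen4 ** gen3 = quarter_turn"
    by (simp add: gen_defs quarter_turn_def mat_of_rows_mult)
  then show ?thesis using gens_in_Gam Gam_mult by metis
qed

text \<open>
  For transvections along a chain \<open>a, b, c\<close>, the fourth power of their product is the square of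
  the transvection along \<open>a + c\<close> (up to the signs of \<open>a\<close> and \<open>c\<close>). Here the chain is
  \<open>e\<^sub>1 - e\<^sub>2, f\<^sub>2, e\<^sub>2\<close>, so the result is a squared transvection along \<open>e\<^sub>1\<close>. The
  transvection along \<open>e\<^sub>1\<close> itself is not in \<open>Gam\<close>.
\<close>
lemma chain_relation: "(gen2 ** gen3 ** gen4) ** (gen2 ** gen3 ** gen4) **
    ((gen2 ** gen3 ** gen4) ** (gen2 ** gen3 ** gen4)) = U11 (- 2)"
  by (simp add: gen_defs U11_def mat_of_rows_mult)

lemma U11_Gam: "U11 (2 * t) \<in> Gam"
proof -
  have "U11 (- 2) \<in> Gam"
    unfolding chain_relation[symmetric] by (intro Gam_mult gens_in_Gam)
  from Gam_one_parameter[OF elementary_add(1) elementary_0(1) this, of "- t"]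
  show ?thesis by simp
qed

text \<open>
  For a chain \<open>a, b, c\<close> the product \<open>t\<^sub>b t\<^sub>a t\<^sub>c t\<^sub>b\<close> of transvections exchanges the lines of
  \<open>a\<close> and \<open>c\<close>, and its square is \<open>x \<mapsto> x \<plusminus> 2 (\<langle>x, a\<rangle> c + \<langle>x, c\<rangle> a)\<close>. The chain
  \<open>f\<^sub>1, e\<^sub>1 - e\<^sub>2, f\<^sub>2\<close> gives \<open>L12\<close>; the chain \<open>e\<^sub>1 - e\<^sub>2, f\<^sub>2, e\<^sub>2\<close> gives \<open>U12\<close>
  times a power of the transvection along \<open>e\<^sub>2\<close>.
\<close>
lemma L12_Gam: "L12 (2 * t) \<in> Gam"
proof -
  have "(gen2 ** gen1 ** gen3 ** gen2) ** (gen2 ** gen1 ** gen3 ** gen2) = L12 2"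
    by (simp add: gen_defs L12_def mat_of_rows_mult)
  then have "L12 2 \<in> Gam"
    by (metis Gam_mult gens_in_Gam)
  from Gam_one_parameter[OF elementary_add(5) elementary_0(5) this]
  show ?thesis .
qed

lemma U12_Gam: "U12 (2 * t) \<in> Gam"
proof -
  have "(gen3 ** gen2 ** gen4 ** gen3) ** (gen3 ** gen2 ** gen4 ** gen3) ** U22 (- 4) = U12 (- 2)"
    by (simp add: gen_defs elementary_defs mat_of_rows_mult)
  then have "U12 (- 2) \<in> Gam"
    by (metis Gam_mult gens_in_Gam U22_Gam)
  from Gam_one_parameter[OF elementary_add(2) elementary_0(2) this, of "- t"]
  show ?thesis by simp
qed

lemma Gam_cancel_left:
  assumes "B \<in> Gam" "A \<in> carrier Sp4Z" "B ** A \<in> Gam"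
  shows "A \<in> Gam"
proof -
  have "inv\<^bsub>Sp4Z\<^esub> B ** (B ** A) \<in> Gam"
    using assms subgroup.m_inv_closed[OF Gam_subgroup] by (simp add: Gam_mult)
  moreover have "inv\<^bsub>Sp4Z\<^esub> B ** (B ** A) = A"
    using Z.l_inv[OF Gam_carrier[OF assms(1)]] by (simp add: matrix_mul_assoc)
  ultimately show ?thesis by simp
qed

lemma Gam_cancel_right:
  assumes "A ** B = C" "B \<in> Gam" "C \<in> Gam"
  shows "A \<in> Gam"
proof -
  have "C ** inv\<^bsub>Sp4Z\<^esub> B \<in> Gam"
    using assms subgroup.m_inv_closed[OF Gam_subgroup] by (simp add: Gam_mult)
  moreover have "C ** inv\<^bsub>Sp4Z\<^esub> B = A"
    using Z.r_inv[OF Gam_carrier[OF assms(2)]] by (simp flip: matrix_mul_assoc assms(1))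
  ultimately show ?thesis by simp
qed

lemma E21_Gam: "E21 (2 * t) \<in> Gam"
proof (rule Gam_cancel_right[OF _ quarter_turn_Gam])
  show "E21 (2 * t) ** quarter_turn = quarter_turn ** L12 (2 * (- t))"
    by (simp add: elementary_defs quarter_turn_def mat_of_rows_mult)
  show "quarter_turn ** L12 (2 * (- t)) \<in> Gam"
    by (intro Gam_mult quarter_turn_Gam L12_Gam)
qed

lemma E12_Gam: "E12 (2 * t) \<in> Gam"
proof (rule Gam_cancel_right[OF _ quarter_turn_Gam])
  show "E12 (2 * t) ** quarter_turn = quarter_turn ** U12 (2 * (- t))"
    by (simp add: elementary_defs quarter_turn_def mat_of_rows_mult)
  show "quarter_turn ** U12 (2 * (- t)) \<in> Gam"
    by (intro Gam_mult quarter_turn_Gam U12_Gam)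
qed

definition neg13 :: "int^4^4" where
  "neg13 = mat_of_rows [[-1,0,0,0],[0,1,0,0],[0,0,-1,0],[0,0,0,1]]"
definition neg24 :: "int^4^4" where
  "neg24 = mat_of_rows [[1,0,0,0],[0,-1,0,0],[0,0,1,0],[0,0,0,-1]]"

lemma neg24_Gam: "neg24 \<in> Gam"
proof -
  have "quarter_turn ** quarter_turn = neg24"
    by (simp add: quarter_turn_def neg24_def mat_of_rows_mult)
  then show ?thesis by (metis quarter_turn_Gam Gam_mult)
qed

lemma neg13_Gam: "neg13 \<in> Gam"
proof -
  \<comment> \<open>The fifth power of the product of the whole chain is \<open>-1\<close>, the hyperelliptic involution.\<close>
  define c where "c = gen1 ** gen2 ** gen3 ** gen4"
  have "c ** c ** c ** c ** c ** neg24 = neg13"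
    by (simp add: c_def gen_defs neg24_def neg13_def mat_of_rows_mult)
  moreover have "c \<in> Gam" unfolding c_def by (intro Gam_mult gens_in_Gam)
  ultimately show ?thesis by (metis neg24_Gam Gam_mult)
qed

text \<open>
  The Euclidean step with even quotients. The remainder of \<open>b\<close> modulo \<open>2 a\<close> of least absolute value
  is even, hence different from \<open>\<plusminus> a\<close>, and nonzero because \<open>a\<close> does not divide \<open>b\<close>. As it is strictly
  between \<open>0\<close> and \<open>\<bar>a\<bar>\<close> in absolute value, adding or subtracting twice this remainder shrinks \<open>a\<close>.
\<close>
lemma odd_even_descent:
  fixes a b :: int
  assumes "odd a" "even b" "\<not> a dvd b"
  obtains s t where "\<bar>a + 2 * s * (b + 2 * t * a)\<bar> < \<bar>a\<bar>"
proof -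
  \<comment> \<open>Shifting by \<open>m\<close> centres the remainder in \<open>{- m..<m}\<close>; the sign of \<open>a\<close> turns a multiple of \<open>m\<close> into one of \<open>a\<close>.\<close>
  define m where "m = \<bar>a\<bar>"
  define q where "q = (b + m) div (2 * m)"
  define r where "r = (b + m) mod (2 * m) - m"
  define t where "t = - q * sgn a"
  have m: "m > 0" using assms(1) by (auto simp: m_def)
  have "r = b - 2 * m * q"
    using mult_div_mod_eq[of "2 * m" "b + m"] unfolding r_def q_def by linarith
  also have "m = sgn a * a" by (simp add: m_def abs_sgn mult.commute)
  finally have r: "r = b + 2 * t * a" by (simp add: t_def algebra_simps)
  have "\<bar>r\<bar> \<le> m"
    using pos_mod_bound[of "2 * m" "b + m"] pos_mod_sign[of "2 * m" "b + m"] m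
    unfolding r_def by linarith
  moreover have "even r" "odd m" using assms by (simp_all add: r m_def)
  then have "\<bar>r\<bar> \<noteq> m" by (metis dvd_abs_iff)
  moreover have "r \<noteq> 0"
  proof
    assume "r = 0"
    then have "b = a * (- 2 * t)" using r by (simp add: algebra_simps)
    then show False using assms(3) by simp
  qed
  ultimately have "\<bar>a + 2 * r\<bar> < \<bar>a\<bar> \<or> \<bar>a - 2 * r\<bar> < \<bar>a\<bar>"
    unfolding m_def by linarith
  then have "\<bar>a + 2 * 1 * r\<bar> < \<bar>a\<bar> \<or> \<bar>a + 2 * (- 1) * r\<bar> < \<bar>a\<bar>"
    by simp
  then show ?thesis using that[of 1 t] that[of "- 1" t] unfolding r by blast
qed

section \<open>\<open>Gam\<close> contains the congruence subgroup of level two\<close>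

lemma elementary_Gamma2:
  "U11 (2 * t) \<in> Gam \<inter> Gamma2" "U12 (2 * t) \<in> Gam \<inter> Gamma2"
  "L11 (2 * t) \<in> Gam \<inter> Gamma2" "L12 (2 * t) \<in> Gam \<inter> Gamma2"
  "E12 (2 * t) \<in> Gam \<inter> Gamma2" "E21 (2 * t) \<in> Gam \<inter> Gamma2"
  "neg13 \<in> Gam \<inter> Gamma2"
proof -
  note G = U11_Gam[of t] U12_Gam[of t] L11_Gam[of "2 * t"] L12_Gam[of t] E12_Gam[of t] E21_Gam[of t] neg13_Gam
  have "even (M $ i $ j) \<longleftrightarrow> i \<noteq> j"
    if "M \<in> {U11 (2 * t), U12 (2 * t), L11 (2 * t), L12 (2 * t), E12 (2 * t), E21 (2 * t), neg13}" for M i j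
    using exhaust_4[of i] exhaust_4[of j] that by (elim insertE disjE emptyE) (simp_all add: elementary_defs neg13_def)
  then show "U11 (2 * t) \<in> Gam \<inter> Gamma2" "U12 (2 * t) \<in> Gam \<inter> Gamma2"
    "L11 (2 * t) \<in> Gam \<inter> Gamma2" "L12 (2 * t) \<in> Gam \<inter> Gamma2"
    "E12 (2 * t) \<in> Gam \<inter> Gamma2" "E21 (2 * t) \<in> Gam \<inter> Gamma2" "neg13 \<in> Gam \<inter> Gamma2"
    using G by (simp_all add: Gamma2_iff Gam_carrier)
qed

lemma Gam_Gamma2_mult: "A \<in> Gam \<inter> Gamma2 \<Longrightarrow> B \<in> Gam \<inter> Gamma2 \<Longrightarrow> A ** B \<in> Gam \<inter> Gamma2"
  using subgroup.m_closed[OF Gamma2_subgroup, of A B] by (simp add: Gam_mult)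

text \<open>
  Row reduction inside \<open>Gamma2\<close>: the reducing matrices lie in \<open>Gam\<close>, so they do not affect membership
  in \<open>Gam\<close>, and in \<open>Gamma2\<close>, so they preserve the parities that the descent relies on.
\<close>
lemma Gamma2_reduce:
  assumes "A \<in> Gamma2" "B \<in> Gam \<inter> Gamma2" "B ** A \<in> Gamma2 \<Longrightarrow> B ** A \<in> Gam"
  shows "A \<in> Gam"
proof -
  have "B ** A \<in> Gamma2"
    using subgroup.m_closed[OF Gamma2_subgroup, of B A] assms(1,2) by simp
  then show ?thesis
    using assms Gam_cancel_left[of B A] by (simp add: Gamma2_iff)
qed

definition block24 :: "int \<Rightarrow> int \<Rightarrow> int \<Rightarrow> int \<Rightarrow> int^4^4" where
  "block24 a b c d = mat_of_rows [[1,0,0,0],[0,a,0,b],[0,0,1,0],[0,c,0,d]]"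

lemma block24_carrier: "a * d - b * c = 1 \<Longrightarrow> block24 a b c d \<in> carrier Sp4Z"
  by (simp add: Sp4_carrier_columns forall_4 pairing_def column_def block24_def symp_form_def algebra_simps)

text \<open>
  The rank one case, level two in \<open>SL(2, Z)\<close>: the Euclidean algorithm on the first column, using the
  upper and lower transvections in the plane of \<open>e\<^sub>2, f\<^sub>2\<close>.
\<close>
lemma block24_Gam:
  assumes "odd a" "even c" "a * d - b * c = 1"
  shows "block24 a b c d \<in> Gam"
  using assms
proof (induction "nat \<bar>a\<bar>" arbitrary: a b c d rule: less_induct)
  case less
  show ?case
  proof (cases "a dvd c")
    case False
    then obtain s t where st: "\<bar>a + 2 * s * (c + 2 * t * a)\<bar> < \<bar>a\<bar>"
      using odd_even_descent less.prems by metis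
    define c' d' a' b' where "c' = c + 2 * t * a" and "d' = d + 2 * t * b"
      and "a' = a + 2 * s * c'" and "b' = b + 2 * s * d'"
    have eq: "(U22 (2 * s) ** L22 (2 * t)) ** block24 a b c d = block24 a' b' c' d'"
      by (simp add: elementary_defs block24_def mat_of_rows_mult a'_def b'_def c'_def d'_def algebra_simps)
    have "a' * d' - b' * c' = a * d - b * c"
      by (simp add: a'_def b'_def c'_def d'_def algebra_simps)
    then have "block24 a' b' c' d' \<in> Gam"
      using less.prems st by (intro less.hyps) (auto simp: a'_def c'_def)
    then show ?thesis
      using Gam_cancel_left[of "U22 (2 * s) ** L22 (2 * t)" "block24 a b c d"] eq
        block24_carrier less.prems Gam_mult U22_Gam L22_Gam by simp
  next
    case True
    then obtain k where k: "c = a * k" by auto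
    have "a * (d - b * k) = 1" using less.prems(3) k by (simp add: algebra_simps)
    then consider "a = 1" "d - b * k = 1" | "a = -1" "d - b * k = -1"
      using zmult_eq_1_iff by blast
    then show ?thesis
    proof cases
      case 1
      then have "block24 a b c d = L22 k ** U22 b"
        by (simp add: k elementary_defs block24_def mat_of_rows_mult algebra_simps)
      then show ?thesis by (simp add: Gam_mult U22_Gam L22_Gam)
    next
      case 2
      then have "block24 a b c d = neg24 ** L22 k ** U22 (- b)"
        by (simp add: k elementary_defs neg24_def block24_def mat_of_rows_mult mat4_eq_iff forall_4 algebra_simps)
      then show ?thesis by (simp add: Gam_mult U22_Gam L22_Gam neg24_Gam)
    qed
  qed
qed

lemma symp_form_entries:
  "symp_form $ 1 $ 2 = 0" "symp_form $ 1 $ 3 = 1" "symp_form $ 1 $ 4 = 0"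
  "symp_form $ 2 $ 3 = 0" "symp_form $ 2 $ 4 = 1" "symp_form $ 3 $ 4 = 0"
  by (simp_all add: symp_form_def)

text \<open>
  The orthogonal complement of the fixed pair \<open>e\<^sub>1, f\<^sub>1\<close> is preserved, so only a block on
  \<open>e\<^sub>2, f\<^sub>2\<close> remains.
\<close>
lemma fixes_hyperbolic_pair_Gam:
  assumes A: "A \<in> Gamma2"
    and col1: "A$1$1 = 1" "A$2$1 = 0" "A$3$1 = 0" "A$4$1 = 0"
    and col3: "A$1$3 = 0" "A$2$3 = 0" "A$3$3 = 1" "A$4$3 = 0"
  shows "A \<in> Gam"
proof -
  have carr: "A \<in> carrier Sp4Z" using A by (simp add: Gamma2_iff)
  note rel = Sp4_carrier_relations[OF carr]
  have "A$3$2 = 0" using rel[of 1 2] by (simp add: col1 symp_form_entries)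
  moreover have "A$3$4 = 0" using rel[of 1 4] by (simp add: col1 symp_form_entries)
  moreover have "A$1$2 = 0" using rel[of 2 3] by (simp add: col3 symp_form_entries)
  moreover have "A$1$4 = 0" using rel[of 3 4] by (simp add: col3 symp_form_entries)
  ultimately have "A = block24 (A$2$2) (A$2$4) (A$4$2) (A$4$4)" and "A$2$2 * A$4$4 - A$2$4 * A$4$2 = 1"
    using rel[of 2 4] by (simp_all add: col1 col3 symp_form_entries block24_def mat4_eq_iff forall_4 algebra_simps)
  moreover have "odd (A$2$2)" "even (A$4$2)" using A by (simp_all add: Gamma2_iff)
  ultimately show ?thesis using block24_Gam by metis
qed

text \<open>
  Since \<open>e\<^sub>1\<close> is fixed, the image of \<open>f\<^sub>1\<close> has \<open>f\<^sub>1\<close>-coordinate \<open>1\<close>. Its other coordinates are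
  even and are cleared by elementary matrices that fix \<open>e\<^sub>1\<close>.
\<close>
lemma fixes_e1_Gam:
  assumes A: "A \<in> Gamma2" and col1: "A$1$1 = 1" "A$2$1 = 0" "A$3$1 = 0" "A$4$1 = 0"
  shows "A \<in> Gam"
proof -
  have A33: "A$3$3 = 1"
    using Sp4_carrier_relations[of A 1 3] A by (simp add: Gamma2_iff col1 symp_form_entries)
  have "even (A$1$3)" "even (A$2$3)" "even (A$4$3)" using A by (simp_all add: Gamma2_iff)
  then obtain p q s where pqs: "A$1$3 = 2 * p" "A$2$3 = 2 * q" "A$4$3 = 2 * s"
    by (elim evenE)
  \<comment> \<open>\<open>E12\<close> also changes the first coordinate, whence the correction \<open>2 * s * q\<close>.\<close>
  let ?B = "U11 (2 * (- (p + 2 * s * q))) ** (U12 (2 * (- q)) ** E12 (2 * s))"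
  show ?thesis
  proof (rule Gamma2_reduce[OF A, of ?B])
    show "?B \<in> Gam \<inter> Gamma2" by (intro Gam_Gamma2_mult elementary_Gamma2)
    assume "?B ** A \<in> Gamma2"
    then show "?B ** A \<in> Gam"
      by (rule fixes_hyperbolic_pair_Gam)
         (simp_all add: elementary_defs mat_of_rows_mult mat4_mult_entry col1 A33 pqs algebra_simps)
  qed
qed

lemma corner_1_Gam:
  assumes A: "A \<in> Gamma2" and corner: "A$1$1 = 1"
  shows "A \<in> Gam"
proof -
  have "even (A$2$1)" "even (A$3$1)" "even (A$4$1)" using A by (simp_all add: Gamma2_iff)
  then obtain p q s where pqs: "A$2$1 = 2 * p" "A$3$1 = 2 * q" "A$4$1 = 2 * s"
    by (elim evenE)
  \<comment> \<open>\<open>E21\<close> also changes the third coordinate, whence the correction \<open>2 * p * s\<close>.\<close>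
  let ?B = "L11 (2 * (- (q + 2 * p * s))) ** (L12 (2 * (- s)) ** E21 (2 * (- p)))"
  show ?thesis
  proof (rule Gamma2_reduce[OF A, of ?B])
    show "?B \<in> Gam \<inter> Gamma2" by (intro Gam_Gamma2_mult elementary_Gamma2)
    assume "?B ** A \<in> Gamma2"
    then show "?B ** A \<in> Gam"
      by (rule fixes_e1_Gam)
         (simp_all add: elementary_defs mat_of_rows_mult mat4_mult_entry corner pqs algebra_simps)
  qed
qed

text \<open>
  The first and third columns pair to \<open>1\<close>, so a common divisor of the first column is a unit.
\<close>
lemma corner_dvd_Gam:
  assumes A: "A \<in> Gamma2" and dvd: "A$1$1 dvd A$2$1" "A$1$1 dvd A$3$1" "A$1$1 dvd A$4$1"
  shows "A \<in> Gam"
proof -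
  have "A$1$1 * A$3$3 - A$3$1 * A$1$3 + A$2$1 * A$4$3 - A$4$1 * A$2$3 = 1"
    using Sp4_carrier_relations[of A 1 3] A by (simp add: Gamma2_iff symp_form_entries)
  moreover have "A$1$1 dvd A$1$1 * A$3$3 - A$3$1 * A$1$3 + A$2$1 * A$4$3 - A$4$1 * A$2$3"
    using dvd by simp
  ultimately have "A$1$1 dvd 1" by simp
  then consider "A$1$1 = 1" | "A$1$1 = -1" unfolding zdvd1_eq by linarith
  then show ?thesis
  proof cases
    case 1
    then show ?thesis using A corner_1_Gam by simp
  next
    case 2
    show ?thesis
    proof (rule Gamma2_reduce[OF A elementary_Gamma2(7)])
      assume "neg13 ** A \<in> Gamma2"
      then show "neg13 ** A \<in> Gam"
        by (rule corner_1_Gam) (simp add: neg13_def mat4_mult_entry 2)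
    qed
  qed
qed

text \<open>
  Descent on the absolute value of the upper left entry: as long as it fails to divide another entry of
  its column, two elementary matrices of level two make it smaller.
\<close>
theorem Gamma2_subset_Gam: "Gamma2 \<subseteq> Gam"
proof
  fix A assume "A \<in> Gamma2"
  then show "A \<in> Gam"
  proof (induction "nat \<bar>A$1$1\<bar>" arbitrary: A rule: less_induct)
    case less
    have par: "odd (A$1$1)" "even (A$2$1)" "even (A$3$1)" "even (A$4$1)"
      using less.prems by (simp_all add: Gamma2_iff)
    have shrink: "A \<in> Gam" if "B \<in> Gam \<inter> Gamma2" "\<bar>(B ** A)$1$1\<bar> < \<bar>A$1$1\<bar>" for B
      by (rule Gamma2_reduce[OF less.prems that(1)]) (rule less.hyps, use that(2) in auto)
    consider "A$1$1 dvd A$2$1" "A$1$1 dvd A$3$1" "A$1$1 dvd A$4$1" | "\<not> A$1$1 dvd A$2$1"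
      | "\<not> A$1$1 dvd A$3$1" | "\<not> A$1$1 dvd A$4$1" by blast
    then show ?case
    proof cases
      case 1
      then show ?thesis using less.prems corner_dvd_Gam by simp
    next
      case 2
      then obtain s t where "\<bar>A$1$1 + 2 * s * (A$2$1 + 2 * t * A$1$1)\<bar> < \<bar>A$1$1\<bar>"
        using odd_even_descent par by metis
      then show ?thesis
        by (intro shrink[of "E12 (2 * s) ** E21 (2 * t)"] Gam_Gamma2_mult elementary_Gamma2)
           (simp add: elementary_defs mat_of_rows_mult mat4_mult_entry algebra_simps)
    next
      case 3
      then obtain s t where "\<bar>A$1$1 + 2 * s * (A$3$1 + 2 * t * A$1$1)\<bar> < \<bar>A$1$1\<bar>"
        using odd_even_descent par by metis
      then show ?thesis
        by (intro shrink[of "U11 (2 * s) ** L11 (2 * t)"] Gam_Gamma2_mult elementary_Gamma2)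
           (simp add: elementary_defs mat_of_rows_mult mat4_mult_entry algebra_simps)
    next
      case 4
      then obtain s t where "\<bar>A$1$1 + 2 * s * (A$4$1 + 2 * t * A$1$1)\<bar> < \<bar>A$1$1\<bar>"
        using odd_even_descent par by metis
      then show ?thesis
        by (intro shrink[of "U12 (2 * s) ** L12 (2 * t)"] Gam_Gamma2_mult elementary_Gamma2)
           (simp add: elementary_defs mat_of_rows_mult mat4_mult_entry algebra_simps)
    qed
  qed
qed

section \<open>Adjacent transpositions generate the symmetric group\<close>

lemma adjacent_transpositions_generate:
  "generate (sym_group n) {Transposition.transpose i (Suc i) | i. 1 \<le> i \<and> i < n} = carrier (sym_group n)"
    (is "generate ?S ?T = _")
proof
  interpret S: group ?S by (rule sym_group_is_group)
  have T: "?T \<subseteq> carrier ?S"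
    by (auto simp: sym_group_carrier intro!: permutes_swap_id)
  then show "generate ?S ?T \<subseteq> carrier ?S" by (rule S.generate_incl)
  have comp: "f \<circ> g \<in> generate ?S ?T" if "f \<in> generate ?S ?T" "g \<in> generate ?S ?T" for f g
    using generate.eng[OF that] by (simp add: sym_group_mult)
  have up: "Transposition.transpose i (i + Suc k) \<in> generate ?S ?T" if "1 \<le> i" "i + Suc k \<le> n" for i k
    using that(2)
  proof (induction k)
    case 0
    then show ?case using that(1) by (intro generate.incl) auto
  next
    case (Suc k)
    let ?s = "Transposition.transpose (i + Suc k) (i + Suc (Suc k))"
    have s: "?s \<in> generate ?S ?T"
      using Suc.prems that(1) by (intro generate.incl) auto
    have t: "Transposition.transpose i (i + Suc k) \<in> generate ?S ?T"
      using Suc by simp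
    have eq: "Transposition.transpose i (i + Suc (Suc k)) =
        Transposition.transpose i (i + Suc k) \<circ> ?s \<circ> Transposition.transpose i (i + Suc k)"
      by (subst transpose_comp_triple) auto
    show ?case unfolding eq by (rule comp[OF comp[OF t s] t])
  qed
  have swap_in: "Transposition.transpose a b \<in> generate ?S ?T"
    if "a \<in> {1..n}" "b \<in> {1..n}" "a \<noteq> b" for a b
  proof -
    have lt: "Transposition.transpose a b \<in> generate ?S ?T" if "1 \<le> a" "b \<le> n" "a < b" for a b
      using up[of a "b - Suc a"] that by simp
    show ?thesis
      using that lt[of a b] lt[of b a] by (cases "a < b") (auto simp: transpose_commute)
  qed
  show "carrier ?S \<subseteq> generate ?S ?T"
  proof
    fix p assume "p \<in> carrier ?S"
    then have "p permutes {1..n}" by (simp add: sym_group_carrier)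
    from this finite_atLeastAtMost[of 1 n] show "p \<in> generate ?S ?T"
    proof (induction rule: permutes_induct)
      case id
      show ?case using generate.one[of ?S ?T] unfolding sym_group_one .
    next
      case (swap a b p)
      then show ?case using swap_in comp by blast
    qed
  qed
qed

section \<open>The six odd quadratic forms modulo 2\<close>

text \<open>
  Over the field with two elements, the quadratic forms \<open>q\<close> with
  \<open>q (x + y) = q x + q y + \<langle>x, y\<rangle>\<close> are the functions \<open>quad_form p\<close>, one for each vector \<open>p\<close>. A
  symplectic matrix permutes them by transport of structure. The Arf invariant of \<open>quad_form p\<close> is
  \<open>base_form p\<close>. Six of the sixteen forms, the odd ones, have Arf invariant \<open>1\<close> and take the value
  \<open>1\<close> ten times; the other ten take it six times. The action on the six odd forms is the isomorphism
  with the symmetric group.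
\<close>

lemma pairing_matrix_vector:
  assumes "A \<in> carrier Sp4"
  shows "pairing (A *v x) (A *v y) = pairing x y"
proof -
  have "pairing (A *v x) (A *v y) =
      (\<Sum>i\<in>UNIV. \<Sum>j\<in>UNIV. x$i * y$j * pairing (column i A) (column j A))"
    by (simp add: sum_4 pairing_def matrix_vector_mult_def column_def algebra_simps)
  also have "\<dots> = (\<Sum>i\<in>UNIV. \<Sum>j\<in>UNIV. x$i * y$j * symp_form $ i $ j)"
    using assms by (simp add: Sp4_carrier_columns)
  also have "\<dots> = pairing x y"
    by (simp add: sum_4 pairing_def symp_form_def algebra_simps)
  finally show ?thesis .
qed

definition base_form :: "bit^4 \<Rightarrow> bit" where
  "base_form x = x$1 * x$3 + x$2 * x$4"

definition quad_form :: "bit^4 \<Rightarrow> bit^4 \<Rightarrow> bit" where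
  "quad_form p x = base_form x + pairing p x"

lemma pairing_add:
  "pairing (x + y) z = pairing x z + pairing y z" "pairing z (x + y) = pairing z x + pairing z y"
  by (simp_all add: pairing_def algebra_simps)

lemma bit_add_self: "(b::bit) + b = 0"
  by (cases b) simp_all

lemma bit_add_left_self: "(a::bit) + (a + b) = b"
  by (cases a; cases b) simp_all

lemmas bit_cancel = ac_simps bit_add_self bit_add_left_self add_0_left add_0_right

lemma pairing_commute_bit: "pairing x y = pairing y (x :: bit^4)"
  unfolding pairing_def minus_bit_def by (simp only: ac_simps)

lemma base_form_add: "base_form (x + y) = base_form x + base_form y + pairing x y"
  unfolding base_form_def pairing_def minus_bit_def vector_add_component
  by (simp only: distrib_left distrib_right ac_simps)

lemma additive_bit4:
  fixes f :: "bit^4 \<Rightarrow> bit"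
  assumes add: "\<And>x y. f (x + y) = f x + f y"
  shows "f x = x$1 * f (axis 1 1) + x$2 * f (axis 2 1) + x$3 * f (axis 3 1) + x$4 * f (axis 4 1)"
proof -
  have f0: "f 0 = 0" using add[of 0 0] by (simp add: bit_add_self)
  have scale: "f (axis i b) = b * f (axis i 1)" for i b
    by (cases b) (auto simp: f0 axis_eq_0_iff[THEN iffD2])
  have "x = axis 1 (x$1) + axis 2 (x$2) + axis 3 (x$3) + axis 4 (x$4)"
    by (simp add: vec_eq_iff forall_4 axis_def)
  then have "f x = f (axis 1 (x$1)) + f (axis 2 (x$2)) + f (axis 3 (x$3)) + f (axis 4 (x$4))"
    by (metis add)
  then show ?thesis using scale by metis
qed

lemma matrix_vector_axis: "(A :: bit^4^4) *v axis i 1 = column i A"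
  by (simp add: vec_eq_iff matrix_vector_mult_def column_def axis_def if_distrib cong: if_cong)

lemma vector_4 [simp]:
  "(vector [a, b, c, d] :: 'a::zero^4) $ 1 = a" "(vector [a, b, c, d] :: 'a^4) $ 2 = b"
  "(vector [a, b, c, d] :: 'a^4) $ 3 = c" "(vector [a, b, c, d] :: 'a^4) $ 4 = d"
  by (simp_all add: vector_def)

lemma pairing_axis:
  fixes p :: "bit^4"
  shows "pairing p (axis 1 1) = p$3" "pairing p (axis 2 1) = p$4"
    "pairing p (axis 3 1) = p$1" "pairing p (axis 4 1) = p$2"
  by (simp_all add: pairing_def axis_def)

text \<open>
  The parameter of the form \<open>x \<mapsto> base_form (A *v x)\<close>; the permuted order of the columns comes from
  the duality between \<open>e\<^sub>i\<close> and \<open>f\<^sub>i\<close>.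
\<close>
definition shift :: "bit^4^4 \<Rightarrow> bit^4" where
  "shift A = vector [base_form (column 3 A), base_form (column 4 A), base_form (column 1 A), base_form (column 2 A)]"

text \<open>
  Both sides, as functions of \<open>x\<close>, have the pairing as their polarization, so their difference is
  additive and may be tested on the standard basis.
\<close>
lemma base_form_matrix_vector:
  assumes "A \<in> carrier Sp4F2"
  shows "base_form (A *v x) = base_form x + pairing (shift A) x"
proof -
  define f where "f x = base_form (A *v x) + base_form x + pairing (shift A) x" for x
  have "f (x + y) = f x + f y" for x y
    by (simp only: f_def base_form_add pairing_add matrix_vector_right_distrib pairing_matrix_vector[OF assms] bit_cancel)
  note expand = additive_bit4[of f, OF this]
  have "f (axis i 1) = 0" for i
  proof -
    have "A *v axis i 1 = column i A" by (rule matrix_vector_axis)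
    moreover have "base_form (axis i 1) = 0"
      using exhaust_4[of i] by (auto simp: base_form_def axis_def)
    moreover have "pairing (shift A) (axis i 1) = base_form (column i A)"
      using exhaust_4[of i] by (elim disjE) (simp_all only: shift_def pairing_axis vector_4)
    ultimately show ?thesis by (simp only: f_def bit_add_self add_0_left add_0_right)
  qed
  then have "f x = 0" using expand[of x] by simp
  then show ?thesis
    unfolding f_def by (cases "base_form (A *v x)"; cases "base_form x"; cases "pairing (shift A) x") simp_all
qed

text \<open>
  The action on parameters that transports the form of \<open>p\<close> along \<open>A\<close>. It is affine rather than
  linear because \<open>A\<close> need not fix the base form.
\<close>
definition act :: "bit^4^4 \<Rightarrow> bit^4 \<Rightarrow> bit^4" where
  "act A p = A *v (p + shift A)"

lemma quad_form_act:
  assumes "A \<in> carrier Sp4F2"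
  shows "quad_form (act A p) (A *v x) = quad_form p x"
  by (simp only: quad_form_def act_def base_form_matrix_vector[OF assms] pairing_matrix_vector[OF assms]
      pairing_add bit_cancel)

lemma quad_form_inject:
  assumes "\<And>x. quad_form p x = quad_form p' x"
  shows "p = p'"
proof -
  have "pairing p x = pairing p' x" for x using assms[of x] unfolding quad_form_def add_left_cancel .
  from this[of "axis 1 1"] this[of "axis 2 1"] this[of "axis 3 1"] this[of "axis 4 1"]
  show ?thesis unfolding pairing_axis by (simp add: vec_eq_iff forall_4)
qed

lemma Sp4F2_surj:
  assumes "A \<in> carrier Sp4F2"
  obtains y where "x = A *v y"
proof
  show "x = A *v (inv\<^bsub>Sp4F2\<^esub> A *v x)"
    using F.r_inv[OF assms] by (simp add: matrix_vector_mul_assoc)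
qed

lemma Sp4F2_inj:
  assumes "A \<in> carrier Sp4F2" "A *v x = A *v y"
  shows "x = y"
proof -
  have "inv\<^bsub>Sp4F2\<^esub> A *v (A *v x) = inv\<^bsub>Sp4F2\<^esub> A *v (A *v y)" using assms(2) by simp
  then show ?thesis using F.l_inv[OF assms(1)] by (simp add: matrix_vector_mul_assoc)
qed

lemma act_mult:
  assumes "A \<in> carrier Sp4F2" "B \<in> carrier Sp4F2"
  shows "act (A ** B) p = act A (act B p)"
proof (rule quad_form_inject)
  fix x
  have AB: "A ** B \<in> carrier Sp4F2" using F.m_closed[OF assms] by simp
  obtain y where x: "x = (A ** B) *v y" using Sp4F2_surj[OF AB] .
  have "quad_form (act (A ** B) p) x = quad_form p y" using quad_form_act[OF AB] by (simp add: x)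
  also have "\<dots> = quad_form (act A (act B p)) x"
    using quad_form_act[OF assms(1)] quad_form_act[OF assms(2)]
    by (simp add: x flip: matrix_vector_mul_assoc)
  finally show "quad_form (act (A ** B) p) x = quad_form (act A (act B p)) x" .
qed

text \<open>
  The parameters of the odd forms, ordered so that the sums of neighbours are
  \<open>f\<^sub>1, e\<^sub>1 + e\<^sub>2, f\<^sub>2, e\<^sub>2, f\<^sub>1 + f\<^sub>2\<close>. A transvection along the sum of two odd parameters
  exchanges the corresponding forms and fixes the other odd forms, so the first four sums, the
  generators modulo 2, give the transpositions \<open>(12), (23), (34), (45)\<close>.
\<close>
definition odd_pt :: "nat \<Rightarrow> bit^4" where
  "odd_pt i = (if i = 1 then vector [0,1,0,1] else if i = 2 then vector [0,1,1,1]
     else if i = 3 then vector [1,0,1,1] else if i = 4 then vector [1,0,1,0]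
     else if i = 5 then vector [1,1,1,0] else vector [1,1,0,1])"

lemma atLeastAtMost_1_6: "{1..6::nat} = {1, 2, 3, 4, 5, 6}" by auto

lemma bij_odd_pt: "bij_betw odd_pt {1..6} {p. base_form p = 1}"
proof (rule bij_betw_imageI)
  show "inj_on odd_pt {1..6}"
    unfolding atLeastAtMost_1_6 by (simp add: inj_on_def odd_pt_def vec_eq_iff forall_4)
  have "base_form p = 1 \<longleftrightarrow> p \<in> {odd_pt 1, odd_pt 2, odd_pt 3, odd_pt 4, odd_pt 5, odd_pt 6}" for p
    by (cases "p$1"; cases "p$2"; cases "p$3"; cases "p$4")
       (simp_all add: base_form_def odd_pt_def vec_eq_iff forall_4)
  then show "odd_pt ` {1..6} = {p. base_form p = 1}"
    unfolding atLeastAtMost_1_6 by auto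
qed

lemma card_base_form: "card {x. base_form x = 1} = 6" "card {x. base_form x = 0} = 10"
proof -
  show six: "card {x. base_form x = 1} = 6"
    using bij_betw_same_card[OF bij_odd_pt] by simp
  have "(UNIV :: bit set) = {0, 1}" by (auto intro: bit.exhaust)
  then have "card (UNIV :: bit set) = card {0, 1 :: bit}" by (rule arg_cong)
  then have U: "card (UNIV :: bit set) = 2" by simp
  have card_UNIV: "card (UNIV :: (bit^4) set) = 16"
    by (simp add: U)
  then have fin: "finite (UNIV :: (bit^4) set)"
    by (intro card_ge_0_finite) simp
  have "{x. base_form x = 0} = UNIV - {x. base_form x = 1}" by auto
  then have "card {x. base_form x = 0} = card (UNIV - {x. base_form x = 1})" by (rule arg_cong)
  also have "\<dots> = card (UNIV :: (bit^4) set) - card {x. base_form x = 1}"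
    by (rule card_Diff_subset) (auto intro: finite_subset[OF subset_UNIV fin])
  also have "\<dots> = 10" unfolding card_UNIV six by simp
  finally show "card {x. base_form x = 0} = 10" .
qed

text \<open>
  Up to the constant \<open>base_form p\<close>, the form with parameter \<open>p\<close> is a translate of the base form.
\<close>
lemma card_quad_form:
  "card {x. quad_form p x = 1} = (if base_form p = 1 then 10 else 6)"
proof -
  have "quad_form p x = base_form (x + p) + base_form p" for x
    by (simp only: quad_form_def base_form_add pairing_commute_bit[of x p] bit_cancel)
  then have "{x. quad_form p x = 1} = (\<lambda>x. x + p) -` {x. base_form x = 1 + base_form p}"
    by (cases "base_form p") auto
  also have "card \<dots> = card {x. base_form x = 1 + base_form p}"
    by (rule card_vimage_inj) (auto simp: inj_def intro: surjI[of _ "\<lambda>x. x - p"] image_eqI[of _ _ "_ - p"])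
  finally show ?thesis by (cases "base_form p") (simp_all add: card_base_form)
qed

text \<open>
  The Arf invariant is visible in the number of times that a form takes the value \<open>1\<close>, which is unchanged by
  a bijective substitution.
\<close>
lemma arf_act:
  assumes "A \<in> carrier Sp4F2"
  shows "base_form (act A p) = base_form p"
proof -
  have "bij_betw ((*v) A) {x. quad_form p x = 1} {x. quad_form (act A p) x = 1}"
  proof (rule bij_betw_imageI)
    show "inj_on ((*v) A) {x. quad_form p x = 1}" using Sp4F2_inj[OF assms] by (auto intro: inj_onI)
    show "(*v) A ` {x. quad_form p x = 1} = {x. quad_form (act A p) x = 1}"
    proof (intro equalityI subsetI)
      fix x assume x: "x \<in> {x. quad_form (act A p) x = 1}"
      obtain y where "x = A *v y" using Sp4F2_surj[OF assms] .
      then show "x \<in> (*v) A ` {x. quad_form p x = 1}" using x quad_form_act[OF assms] by auto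
    qed (auto simp: quad_form_act[OF assms])
  qed
  from bij_betw_same_card[OF this] show ?thesis
    by (cases "base_form p"; cases "base_form (act A p)") (simp_all add: card_quad_form)
qed

definition perm_of :: "bit^4^4 \<Rightarrow> nat \<Rightarrow> nat" where
  "perm_of A i = (if i \<in> {1..6} then inv_into {1..6} odd_pt (act A (odd_pt i)) else i)"

lemma odd_pt_in: "i \<in> {1..6} \<Longrightarrow> base_form (odd_pt i) = 1"
  using bij_betw_apply[OF bij_odd_pt] by blast

lemma perm_of_works:
  assumes "A \<in> carrier Sp4F2" "i \<in> {1..6}"
  shows "perm_of A i \<in> {1..6}" "odd_pt (perm_of A i) = act A (odd_pt i)"
proof -
  have "act A (odd_pt i) \<in> {p. base_form p = 1}" using odd_pt_in assms arf_act by simp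
  then have im: "act A (odd_pt i) \<in> odd_pt ` {1..6}"
    using bij_betw_imp_surj_on[OF bij_odd_pt] by simp
  then show "perm_of A i \<in> {1..6}" "odd_pt (perm_of A i) = act A (odd_pt i)"
    using inv_into_into[OF im] f_inv_into_f[OF im] assms(2) by (simp_all add: perm_of_def)
qed

lemma odd_pt_eq_iff: "i \<in> {1..6} \<Longrightarrow> j \<in> {1..6} \<Longrightarrow> odd_pt i = odd_pt j \<longleftrightarrow> i = j"
  using bij_betw_imp_inj_on[OF bij_odd_pt] by (simp add: inj_on_eq_iff)

lemma perm_of_permutes:
  assumes "A \<in> carrier Sp4F2"
  shows "perm_of A permutes {1..6}"
proof (rule bij_imp_permutes)
  have "inj_on (perm_of A) {1..6}"
  proof (rule inj_onI)
    fix i j assume ij: "i \<in> {1..6}" "j \<in> {1..6}" "perm_of A i = perm_of A j"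
    then have "act A (odd_pt i) = act A (odd_pt j)" using perm_of_works(2)[OF assms] by metis
    then have "odd_pt i + shift A = odd_pt j + shift A"
      unfolding act_def by (rule Sp4F2_inj[OF assms])
    then show "i = j" using ij odd_pt_eq_iff by simp
  qed
  moreover have "perm_of A ` {1..6} \<subseteq> {1..6}" using perm_of_works(1)[OF assms] by blast
  ultimately show "bij_betw (perm_of A) {1..6} {1..6}"
    by (simp add: bij_betw_def endo_inj_surj)
qed (auto simp: perm_of_def)

lemma perm_of_eqI:
  assumes "A \<in> carrier Sp4F2" "s permutes {1..6}" "\<And>i. i \<in> {1..6} \<Longrightarrow> act A (odd_pt i) = odd_pt (s i)"
  shows "perm_of A = s"
proof
  fix i
  show "perm_of A i = s i"
  proof (cases "i \<in> {1..6}")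
    case True
    then show ?thesis
      using perm_of_works[OF assms(1) True] assms(3)[OF True] permutes_in_image[OF assms(2)] odd_pt_eq_iff
      by metis
  next
    case False
    then show ?thesis using permutes_not_in[OF assms(2) False] False unfolding perm_of_def by auto
  qed
qed

lemma perm_of_hom: "perm_of \<in> hom Sp4F2 (sym_group 6)"
proof (rule homI)
  show "perm_of A \<in> carrier (sym_group 6)" if "A \<in> carrier Sp4F2" for A
    using perm_of_permutes[OF that] by (simp add: sym_group_carrier)
  fix A B assume AB: "A \<in> carrier Sp4F2" "B \<in> carrier Sp4F2"
  show "perm_of (A \<otimes>\<^bsub>Sp4F2\<^esub> B) = perm_of A \<otimes>\<^bsub>sym_group 6\<^esub> perm_of B"
    unfolding sym_group_mult
  proof (rule perm_of_eqI)
    show "A \<otimes>\<^bsub>Sp4F2\<^esub> B \<in> carrier Sp4F2" using AB by (rule F.m_closed)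
    show "perm_of A \<circ> perm_of B permutes {1..6}"
      using AB perm_of_permutes permutes_compose by blast
    show "act (A \<otimes>\<^bsub>Sp4F2\<^esub> B) (odd_pt i) = odd_pt ((perm_of A \<circ> perm_of B) i)" if "i \<in> {1..6}" for i
      using that perm_of_works[OF AB(1)] perm_of_works[OF AB(2) that] act_mult[OF AB] by simp
  qed
qed

text \<open>
  A matrix that fixes the six odd forms fixes the differences of their parameters (the shift cancels), and
  these span the space.
\<close>
lemma perm_of_inj:
  assumes A: "A \<in> carrier Sp4F2" and id: "perm_of A = id"
  shows "A = mat 1"
proof -
  have "A *v (odd_pt i + odd_pt j) = odd_pt i + odd_pt j" if "i \<in> {1..6}" "j \<in> {1..6}" for i j
  proof -
    have "A *v (odd_pt i + shift A) + A *v (odd_pt j + shift A) = odd_pt i + odd_pt j"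
      using perm_of_works(2)[OF A that(1)] perm_of_works(2)[OF A that(2)] by (simp add: id act_def)
    moreover have "odd_pt i + shift A + (odd_pt j + shift A) = odd_pt i + odd_pt j"
      by (simp add: vec_eq_iff bit_add_self add_ac flip: add.assoc)
    ultimately show ?thesis by (metis matrix_vector_right_distrib)
  qed
  note fixd = this
  have "axis 3 1 = odd_pt 1 + odd_pt 2" "axis 4 1 = odd_pt 3 + odd_pt 4" "axis 2 1 = odd_pt 4 + odd_pt 5"
     "axis 1 1 = (odd_pt 2 + odd_pt 3) + (odd_pt 4 + odd_pt 5)"
    by (simp_all add: odd_pt_def vec_eq_iff forall_4 axis_def)
  then have "A *v axis i 1 = axis i 1" for i
    using exhaust_4[of i] fixd[of 1 2] fixd[of 3 4] fixd[of 4 5] fixd[of 2 3]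
    by (auto simp: matrix_vector_right_distrib)
  then have "column i A = axis i 1" for i by (simp add: matrix_vector_axis)
  then show ?thesis
    by (simp add: vec_eq_iff column_def axis_def mat_def)
qed

text \<open>
  The transvection along \<open>f\<^sub>1 + f\<^sub>2\<close>: an integral matrix that supplies the missing
  transposition \<open>(56)\<close>.
\<close>
definition gen5 :: "int^4^4" where
  "gen5 = mat_of_rows [[1,0,0,0],[0,1,0,0],[1,1,1,0],[1,1,0,1]]"

lemma gen5_carrier: "gen5 \<in> carrier Sp4Z"
  by (simp add: Sp4_carrier_columns forall_4 pairing_def column_def gen5_def symp_form_def)

lemma red2_mat_of_rows:
  "red2 (mat_of_rows [[a11,a12,a13,a14],[a21,a22,a23,a24],[a31,a32,a33,a34],[a41,a42,a43,a44]]) =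
   mat_of_rows [[of_int a11,of_int a12,of_int a13,of_int a14],[of_int a21,of_int a22,of_int a23,of_int a24],
     [of_int a31,of_int a32,of_int a33,of_int a34],[of_int a41,of_int a42,of_int a43,of_int a44]]"
  by (simp add: mat4_eq_iff forall_4 red2_def)

lemma red2_carrier: "A \<in> carrier Sp4Z \<Longrightarrow> red2 A \<in> carrier Sp4F2"
  by (rule red.hom_closed)

lemma perm_of_gens:
  "perm_of (red2 gen1) = Transposition.transpose 1 2"
  "perm_of (red2 gen2) = Transposition.transpose 2 3"
  "perm_of (red2 gen3) = Transposition.transpose 3 4"
  "perm_of (red2 gen4) = Transposition.transpose 4 5"
  "perm_of (red2 gen5) = Transposition.transpose 5 6"
proof -
  have *: "i \<in> {1, 2, 3, 4, 5, 6}" if "i \<in> {1..6::nat}" for i using that by auto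
  have c: "gen1 \<in> carrier Sp4Z" "gen2 \<in> carrier Sp4Z" "gen3 \<in> carrier Sp4Z" "gen4 \<in> carrier Sp4Z"
    using generators_in_Sp4Z by simp_all
  note s = gen1_def gen2_def gen3_def gen4_def gen5_def red2_mat_of_rows act_def shift_def odd_pt_def
      Transposition.transpose_def vec_eq_iff forall_4 matrix_vector_mult_def sum_4 column_def base_form_def
  show "perm_of (red2 gen1) = Transposition.transpose 1 2"
    by (rule perm_of_eqI[OF red2_carrier[OF c(1)] permutes_swap_id]) (auto dest!: * simp: s)
  show "perm_of (red2 gen2) = Transposition.transpose 2 3"
    by (rule perm_of_eqI[OF red2_carrier[OF c(2)] permutes_swap_id]) (auto dest!: * simp: s)
  show "perm_of (red2 gen3) = Transposition.transpose 3 4"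
    by (rule perm_of_eqI[OF red2_carrier[OF c(3)] permutes_swap_id]) (auto dest!: * simp: s)
  show "perm_of (red2 gen4) = Transposition.transpose 4 5"
    by (rule perm_of_eqI[OF red2_carrier[OF c(4)] permutes_swap_id]) (auto dest!: * simp: s)
  show "perm_of (red2 gen5) = Transposition.transpose 5 6"
    by (rule perm_of_eqI[OF red2_carrier[OF gen5_carrier] permutes_swap_id]) (auto dest!: * simp: s)
qed

section \<open>Index and exactness\<close>

text \<open>
  Taking images is a bijection on cosets: if \<open>h a = h (k b)\<close> with \<open>k \<in> K\<close>, then \<open>a\<close> and \<open>k b\<close>
  differ by an element of the kernel, hence of \<open>K\<close>.
\<close>
lemma (in group_hom) card_rcosets_image:
  assumes surj: "h ` carrier G = carrier H" and K: "subgroup K G" and ker: "kernel G H h \<subseteq> K"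
  shows "card (rcosets\<^bsub>H\<^esub> (h ` K)) = card (rcosets\<^bsub>G\<^esub> K)"
proof -
  have KG: "K \<subseteq> carrier G" by (rule subgroup.subset[OF K])
  have image: "h ` (K #>\<^bsub>G\<^esub> a) = h ` K #>\<^bsub>H\<^esub> h a" if "a \<in> carrier G" for a
  proof -
    have "h (k \<otimes> a) = h k \<otimes>\<^bsub>H\<^esub> h a" if "k \<in> K" for k
      using that KG \<open>a \<in> carrier G\<close> by (intro hom_mult) auto
    then show ?thesis by (auto simp: r_coset_def image_UN)
  qed
  have "bij_betw ((`) h) (rcosets\<^bsub>G\<^esub> K) (rcosets\<^bsub>H\<^esub> (h ` K))"
  proof (rule bij_betw_imageI)
    show "inj_on ((`) h) (rcosets\<^bsub>G\<^esub> K)"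
    proof (rule inj_onI)
      fix X Y assume X: "X \<in> rcosets\<^bsub>G\<^esub> K" and Y: "Y \<in> rcosets\<^bsub>G\<^esub> K" and eq: "h ` X = h ` Y"
      obtain a b where a: "a \<in> carrier G" "X = K #>\<^bsub>G\<^esub> a" and b: "b \<in> carrier G" "Y = K #>\<^bsub>G\<^esub> b"
        using X Y by (auto simp: RCOSETS_def)
      have "h a \<in> h ` Y"
        using G.rcos_self[OF a(1) K] eq a(2) by blast
      then obtain k where k: "k \<in> K" "h a = h (k \<otimes> b)"
        by (auto simp: b(2) r_coset_def)
      then have kb: "k \<otimes> b \<in> carrier G" using KG b(1) by blast
      have "h (a \<otimes> inv (k \<otimes> b)) = \<one>\<^bsub>H\<^esub>"
        using a(1) kb k(2) by simp
      then have "a \<otimes> inv (k \<otimes> b) \<in> K"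
        using ker a(1) kb by (auto simp: kernel_def)
      then have "a \<otimes> inv (k \<otimes> b) \<otimes> k \<in> K"
        using k(1) subgroup.m_closed[OF K] by blast
      moreover have "a = a \<otimes> inv (k \<otimes> b) \<otimes> k \<otimes> b"
        using a(1) b(1) kb k(1) KG by (simp add: G.m_assoc subsetD)
      ultimately have "a \<in> K #>\<^bsub>G\<^esub> b"
        by (auto simp: r_coset_def)
      then show "X = Y"
        using G.repr_independence[OF _ b(1) K] a(2) b(2) by simp
    qed
    show "(`) h ` (rcosets\<^bsub>G\<^esub> K) = rcosets\<^bsub>H\<^esub> (h ` K)"
      using image by (auto simp: RCOSETS_def surj[symmetric])
  qed
  then show ?thesis using bij_betw_same_card by fastforce
qed

lemma sym_group_subgroup:
  assumes "m \<le> n"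
  shows "subgroup (carrier (sym_group m)) (sym_group n)"
proof -
  interpret S: group "sym_group n" by (rule sym_group_is_group)
  have sub: "p permutes {1..n}" if "p permutes {1..m}" for p
    using that assms by (intro permutes_subset[OF that]) auto
  show ?thesis
  proof (rule S.subgroupI)
    show "carrier (sym_group m) \<subseteq> carrier (sym_group n)"
      using sub by (auto simp: sym_group_carrier)
    show "carrier (sym_group m) \<noteq> {}"
      using permutes_id[of "{1..m}"] sym_group_carrier by blast
    fix p q assume p: "p \<in> carrier (sym_group m)" and q: "q \<in> carrier (sym_group m)"
    show "inv\<^bsub>sym_group n\<^esub> p \<in> carrier (sym_group m)"
      using p sub permutes_inv by (simp add: sym_group_carrier)
    show "p \<otimes>\<^bsub>sym_group n\<^esub> q \<in> carrier (sym_group m)"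
      using p q permutes_compose by (auto simp: sym_group_carrier sym_group_mult)
  qed
qed

lemma adjacent_transpositions_5:
  "{Transposition.transpose i (Suc i) | i. 1 \<le> i \<and> i < 5} =
   {Transposition.transpose 1 2, Transposition.transpose 2 3, Transposition.transpose 3 4, Transposition.transpose 4 (5::nat)}"
proof -
  have "{i. 1 \<le> i \<and> i < 5} = {1, 2, 3, 4::nat}" by auto
  then have "(\<lambda>i. Transposition.transpose i (Suc i)) ` {i. 1 \<le> i \<and> i < 5} = (\<lambda>i. Transposition.transpose i (Suc i)) ` {1, 2, 3, 4::nat}"
    by (rule arg_cong)
  then show ?thesis by (simp add: image_Collect numeral_eq_Suc)
qed

lemma adjacent_transpositions_6:
  "{Transposition.transpose i (Suc i) | i. 1 \<le> i \<and> i < 6} =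
   {Transposition.transpose 1 2, Transposition.transpose 2 3, Transposition.transpose 3 4, Transposition.transpose 4 5,
    Transposition.transpose 5 (6::nat)}"
proof -
  have "{i. 1 \<le> i \<and> i < 6} = {1, 2, 3, 4, 5::nat}" by auto
  then have "(\<lambda>i. Transposition.transpose i (Suc i)) ` {i. 1 \<le> i \<and> i < 6} = (\<lambda>i. Transposition.transpose i (Suc i)) ` {1, 2, 3, 4, 5::nat}"
    by (rule arg_cong)
  then show ?thesis by (simp add: image_Collect numeral_eq_Suc)
qed

lemma perm_of_red2_hom: "group_hom Sp4Z (sym_group 6) (\<lambda>A. perm_of (red2 A))"
proof -
  have "perm_of \<circ> red2 \<in> hom Sp4Z (sym_group 6)"
    by (rule hom_compose[OF red.homh perm_of_hom])
  then show ?thesis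
    by (simp add: group_hom_def group_hom_axioms_def group_Sp4Z sym_group_is_group comp_def)
qed

text \<open>
  All five adjacent transpositions come from integral matrices. Hence \<open>perm_of\<close> is onto too and,
  being injective, shows that every symplectic matrix modulo 2 lifts to the integers.
\<close>
lemma perm_of_red2_surj: "(\<lambda>A. perm_of (red2 A)) ` carrier Sp4Z = carrier (sym_group 6)"
proof -
  interpret f: group_hom Sp4Z "sym_group 6" "\<lambda>A. perm_of (red2 A)" by (rule perm_of_red2_hom)
  have gens: "{gen1, gen2, gen3, gen4, gen5} \<subseteq> carrier Sp4Z"
    using generators_in_Sp4Z gen5_carrier by simp
  have "carrier (sym_group 6) = (\<lambda>A. perm_of (red2 A)) ` generate Sp4Z {gen1, gen2, gen3, gen4, gen5}"
    using adjacent_transpositions_generate[of 6] f.generate_img[OF gens]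
    unfolding adjacent_transpositions_6 by (simp add: perm_of_gens)
  also have "\<dots> \<subseteq> (\<lambda>A. perm_of (red2 A)) ` carrier Sp4Z"
    using Z.generate_incl[OF gens] by blast
  finally show ?thesis using f.hom_closed by blast
qed

lemma marked_iso_perm_of: "marked_iso perm_of"
proof -
  interpret P: group_hom Sp4F2 "sym_group 6" perm_of
    by (simp add: group_hom_def group_hom_axioms_def group_Sp4F2 sym_group_is_group perm_of_hom)
  have "inj_on perm_of (carrier Sp4F2)"
    unfolding P.inj_on_one_iff using perm_of_inj by (simp add: sym_group_one)
  moreover have "carrier (sym_group 6) \<subseteq> perm_of ` carrier Sp4F2"
    using perm_of_red2_surj red2_carrier by blast
  moreover have "perm_of ` carrier Sp4F2 \<subseteq> carrier (sym_group 6)"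
    using P.hom_closed by blast
  ultimately show ?thesis
    by (simp add: marked_iso_def iso_iff perm_of_hom perm_of_gens subset_antisym)
qed

lemma marked_iso_group_hom:
  assumes "marked_iso \<phi>"
  shows "group_hom Sp4Z (sym_group 6) (\<lambda>A. \<phi> (red2 A))"
proof -
  have "\<phi> \<in> hom Sp4F2 (sym_group 6)" using assms by (simp add: marked_iso_def iso_iff)
  then have "\<phi> \<circ> red2 \<in> hom Sp4Z (sym_group 6)"
    by (rule hom_compose[OF red.homh])
  then show ?thesis
    by (simp add: group_hom_def group_hom_axioms_def group_Sp4Z sym_group_is_group comp_def)
qed

lemma marked_iso_image_Gam:
  assumes "marked_iso \<phi>"
  shows "(\<lambda>A. \<phi> (red2 A)) ` Gam = carrier (sym_group 5)"
proof -
  interpret f: group_hom Sp4Z "sym_group 6" "\<lambda>A. \<phi> (red2 A)" by (rule marked_iso_group_hom[OF assms])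
  let ?T = "{Transposition.transpose i (Suc i) | i. 1 \<le> i \<and> i < (5::nat)}"
  have "(\<lambda>A. \<phi> (red2 A)) ` Gam = generate (sym_group 6) ?T"
    unfolding Gam_def f.generate_img[OF generators_in_Sp4Z, symmetric] adjacent_transpositions_5
    using assms by (simp add: marked_iso_def)
  also have "\<dots> = generate (sym_group 6\<lparr>carrier := carrier (sym_group 5)\<rparr>) ?T"
  proof (rule f.H.generate_consistent[symmetric])
    show "?T \<subseteq> carrier (sym_group 5)"
      by (auto simp: sym_group_carrier intro!: permutes_swap_id)
    show "subgroup (carrier (sym_group 5)) (sym_group 6)" by (rule sym_group_subgroup) simp
  qed
  also have "sym_group 6\<lparr>carrier := carrier (sym_group 5)\<rparr> = sym_group 5"
    by (simp add: sym_group_def)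
  finally show ?thesis unfolding adjacent_transpositions_generate .
qed

lemma marked_iso_kernel:
  assumes "marked_iso \<phi>"
  shows "kernel Sp4Z (sym_group 6) (\<lambda>A. \<phi> (red2 A)) = Gamma2"
proof -
  have "group_hom Sp4F2 (sym_group 6) \<phi>"
    using assms by (simp add: group_hom_def group_hom_axioms_def group_Sp4F2 sym_group_is_group marked_iso_def iso_iff)
  then interpret P: group_hom Sp4F2 "sym_group 6" \<phi> .
  have "inj_on \<phi> (carrier Sp4F2)" using assms by (simp add: marked_iso_def iso_iff)
  then have "\<phi> (red2 A) = \<one>\<^bsub>sym_group 6\<^esub> \<longleftrightarrow> red2 A = \<one>\<^bsub>Sp4F2\<^esub>" if "A \<in> carrier Sp4Z" for A
    using red2_carrier[OF that] P.hom_one unfolding P.inj_on_one_iff by metis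
  then show ?thesis by (auto simp: Gamma2_def kernel_def simp del: Sp4_one)
qed

theorem corollary6p2:
  shows "card (rcosets\<^bsub>Sp4Z\<^esub> Gam) = 6 \<and>
    (\<exists>\<phi>. marked_iso \<phi>) \<and>
    (\<forall>\<phi>. marked_iso \<phi> \<longrightarrow>
       short_exact (Sp4Z\<lparr>carrier := Gamma2\<rparr>) (\<lambda>A. A)
         (Sp4Z\<lparr>carrier := Gam\<rparr>) (\<lambda>A. \<phi> (red2 A)) (sym_group 5))"
proof (intro conjI allI impI)
  show "\<exists>\<phi>. marked_iso \<phi>" using marked_iso_perm_of by blast
next
  interpret f: group_hom Sp4Z "sym_group 6" "\<lambda>A. perm_of (red2 A)" by (rule perm_of_red2_hom)
  have "card (rcosets\<^bsub>sym_group 6\<^esub> (carrier (sym_group 5))) = card (rcosets\<^bsub>Sp4Z\<^esub> Gam)"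
    using f.card_rcosets_image[OF perm_of_red2_surj Gam_subgroup] Gamma2_subset_Gam
    unfolding marked_iso_kernel[OF marked_iso_perm_of] marked_iso_image_Gam[OF marked_iso_perm_of] .
  moreover have "card (rcosets\<^bsub>sym_group 6\<^esub> (carrier (sym_group 5))) * fact 5 = fact 6"
    using f.H.lagrange[OF sym_group_subgroup[of 5 6]]
    by (simp add: order_def sym_group_card_carrier)
  ultimately show "card (rcosets\<^bsub>Sp4Z\<^esub> Gam) = 6"
    by (simp add: fact_numeral)
next
  fix \<phi> assume \<phi>: "marked_iso \<phi>"
  interpret f: group_hom Sp4Z "sym_group 6" "\<lambda>A. \<phi> (red2 A)" by (rule marked_iso_group_hom[OF \<phi>])
  note image = marked_iso_image_Gam[OF \<phi>]
  show "short_exact (Sp4Z\<lparr>carrier := Gamma2\<rparr>) (\<lambda>A. A)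
         (Sp4Z\<lparr>carrier := Gam\<rparr>) (\<lambda>A. \<phi> (red2 A)) (sym_group 5)"
    unfolding short_exact_def
  proof (intro conjI)
    show "group (Sp4Z\<lparr>carrier := Gamma2\<rparr>)" by (rule Z.subgroup_imp_group[OF Gamma2_subgroup])
    show "group (Sp4Z\<lparr>carrier := Gam\<rparr>)" by (rule Z.subgroup_imp_group[OF Gam_subgroup])
    show "group (sym_group 5)" by (rule sym_group_is_group)
    show "(\<lambda>A. A) \<in> mon (Sp4Z\<lparr>carrier := Gamma2\<rparr>) (Sp4Z\<lparr>carrier := Gam\<rparr>)"
      using Gamma2_subset_Gam by (auto simp: mon_def hom_def)
    show "(\<lambda>A. \<phi> (red2 A)) \<in> epi (Sp4Z\<lparr>carrier := Gam\<rparr>) (sym_group 5)"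
      using image Gam_carrier f.hom_mult by (auto simp: epi_def hom_def sym_group_mult)
    show "kernel (Sp4Z\<lparr>carrier := Gam\<rparr>) (sym_group 5) (\<lambda>A. \<phi> (red2 A)) =
        (\<lambda>A. A) ` carrier (Sp4Z\<lparr>carrier := Gamma2\<rparr>)"
      using marked_iso_kernel[OF \<phi>] Gamma2_subset_Gam Gam_carrier
      by (auto simp: kernel_def sym_group_one)
  qed
qed

end
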